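(* For every $K_3N$ $n=pqr$, $A<\sqrt{3(p-1)}-\dfrac12\sqrt[4]{\dfrac{p-1}{12}}$.
   Context: A $K_3N$ (Korselt number with three factors) is an integer $n$ together with a factorisation $n=pqr$, where $1<p<q<r$ are odd integers (not necessarily prime) such that each of $p-1,\ q-1,\ r-1$ divides $n-1$, and such that $E:=\dfrac{pq-1}{r-1}$ (which is an integer by the divisibility condition) satisfies $E\ge 2$. Put $H:=\gcd(p-1,q-1,r-1)$ and $A:=\frac{p-1}{H}$. *)

theory Defs
  imports Complex_Main
begin

text \<open>
  The division in \<open>K3N_E\<close> is exact for the triples of interest, because
  \<open>p * q * r - 1 = p * q * (r - 1) + (p * q - 1)\<close>; see \<open>K3N_E_exact\<close> below.
\<close>

definition K3N_E :: "int \<Rightarrow> int \<Rightarrow> int \<Rightarrow> int" where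
  "K3N_E p q r = (p * q - 1) div (r - 1)"

text \<open>The factors are odd but not required to be prime, and the factorisation is part of the data.\<close>

definition K3N :: "int \<Rightarrow> int \<Rightarrow> int \<Rightarrow> int \<Rightarrow> bool" where
  "K3N n p q r \<longleftrightarrow>
     n = p * q * r \<and> 1 < p \<and> p < q \<and> q < r \<and> odd p \<and> odd q \<and> odd r \<and>
     (p - 1) dvd (n - 1) \<and> (q - 1) dvd (n - 1) \<and> (r - 1) dvd (n - 1) \<and>
     K3N_E p q r \<ge> 2"

definition K3N_H :: "int \<Rightarrow> int \<Rightarrow> int \<Rightarrow> int" where
  "K3N_H p q r = gcd (p - 1) (gcd (q - 1) (r - 1))"

text \<open>Again an exact division, as \<open>K3N_H p q r\<close> divides \<open>p - 1\<close>.\<close>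

definition K3N_A :: "int \<Rightarrow> int \<Rightarrow> int \<Rightarrow> int" where
  "K3N_A p q r = (p - 1) div K3N_H p q r"

lemma K3N_E_exact:
  assumes "n = p * q * r" and "(r - 1) dvd (n - 1)"
  shows "K3N_E p q r * (r - 1) = p * q - 1"
proof -
  have "n - 1 = p * q * (r - 1) + (p * q - 1)"
    using assms(1) by (simp add: algebra_simps)
  then have "(r - 1) dvd (p * q - 1)"
    using assms(2) by (metis dvd_add_right_iff dvd_triv_right)
  then show ?thesis
    by (simp add: K3N_E_def)
qed

lemma K3N_A_exact: "K3N_A p q r * K3N_H p q r = p - 1"
  by (simp add: K3N_A_def K3N_H_def)

end

theory Submission
  imports Defs
begin

text \<open>
  Write \<open>p - 1 = A H\<close>, \<open>q - 1 = B H\<close>, \<open>r - 1 = C H\<close>. The divisibilities force \<open>A\<close>, \<open>B\<close>, \<open>C\<close> to be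
  pairwise coprime, hence \<open>k A B C = A + B + C + H (A B + B C + C A)\<close> for some \<open>k\<close>. Put
  \<open>d = 3 H - A\<close>. Squaring twice, the claim becomes \<open>d > 0\<close> and
  \<open>6 d\<^sup>2 - d - A > (1 + d / A) / 96\<close>, for which the integer inequality \<open>A < 6 d\<^sup>2 - d\<close> suffices.
  If that fails, then \<open>k = 1\<close>, and the equation becomes, with \<open>B = A + b\<close>, \<open>C = A + c\<close> and
  \<open>t = b + c - 3 d\<close>,
  \<open>A\<^sup>2 t + A (2 b c - 9 - 2 d (3 d + t)) - 3 (3 d + t) - d b c = 0\<close>.
  This forces \<open>t \<ge> 1\<close>, while \<open>b c \<ge> b + c - 1\<close> then makes the left side positive for \<open>d \<ge> 4\<close>;
  as \<open>H\<close> is even, only \<open>(A, d) = (5, 1), (11, 1), (22, 2), (51, 3)\<close> remain, and these fail modulo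
  small numbers or by size.
\<close>

section \<open>Reduction of the radical inequality to a polynomial one\<close>

text \<open>For \<open>y = sqrt (3 * (A * H))\<close> the root term equals
  \<open>sqrt (y / 24)\<close>, so \<open>A < y\<close> and \<open>y / 24 < (y - A)^2\<close>
  suffice. Since \<open>y^2 = A * (A + d)\<close>, the latter is linear in \<open>y\<close>, and one
  more squaring turns it into \<open>gap\<close>.\<close>

lemma less_sqrt_minus_root_if_excess_large:
  fixes A H d :: real
  assumes "A > 0" and "d > 0" and H: "3 * H = A + d"
    and gap: "96 * A\<^sup>2 + A + 96 * A * d + d < 576 * A * d\<^sup>2"
  shows "A < sqrt (3 * (A * H)) - 1 / 2 * root 4 ((A * H) / 12)"
proof -
  define y where "y = sqrt (3 * (A * H))"
  have AH: "3 * (A * H) = A * (A + d)"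
    using H by (metis mult.left_commute)
  have y2: "y\<^sup>2 = A * (A + d)"
    using assms(1,2) unfolding y_def AH by simp
  have "y > 0"
    using assms(1,2) unfolding y_def AH by simp
  have "A\<^sup>2 < y\<^sup>2"
    using assms(1,2) unfolding y2 by (simp add: power2_eq_square algebra_simps)
  then have "A < y"
    using \<open>y > 0\<close> by (simp add: power2_less_imp_less)
  \<comment> \<open>Expanding \<open>y / 24 < (y - A)^2\<close> leaves
    \<open>(2 * A + 1 / 24) * y < A * (2 * A + d)\<close>. The squares of its sides differ by
    \<open>A / 576\<close> times the slack in \<open>gap\<close>.\<close>
  have "((2 * A + 1 / 24) * y)\<^sup>2 < (A * (2 * A + d))\<^sup>2"
  proof -
    have "(A * (2 * A + d))\<^sup>2 - ((2 * A + 1 / 24) * y)\<^sup>2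
        = A / 576 * (576 * A * d\<^sup>2 - (96 * A\<^sup>2 + A + 96 * A * d + d))"
      unfolding power_mult_distrib y2 by (simp add: power2_eq_square field_simps)
    moreover have "\<dots> > 0"
      using gap \<open>A > 0\<close> by simp
    ultimately show ?thesis by linarith
  qed
  then have "(2 * A + 1 / 24) * y < A * (2 * A + d)"
    using assms(1,2) by (simp add: power2_less_imp_less)
  then have "y / 24 < (y - A)\<^sup>2"
    using y2 by (simp add: power2_eq_square algebra_simps)
  then have "sqrt (y / 24) < y - A"
    using \<open>A < y\<close> by (simp add: real_less_lsqrt)
  moreover have "sqrt (y / 24) = 1 / 2 * root 4 ((A * H) / 12)"
  proof -
    have "A * H / 12 = (y / 6)\<^sup>2"
      using AH y2 by (simp add: power_divide)
    then have "A * H / 12 = (sqrt (y / 6)) ^ 4"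
      using \<open>y > 0\<close> real_sqrt_pow2[of "y / 6"]
      by (metis (no_types) divide_pos_pos less_imp_le mult_2 numeral_Bit0 power2_eq_square
          power_add zero_less_numeral)
    then have "root 4 ((A * H) / 12) = sqrt (y / 6)"
      using \<open>y > 0\<close> by (simp add: real_root_power_cancel)
    moreover have "sqrt (y / 24) = sqrt (1 / 4) * sqrt (y / 6)"
      by (simp flip: real_sqrt_mult)
    moreover have "sqrt (1 / 4) = (1 / 2 :: real)"
      by (simp add: real_sqrt_divide)
    ultimately show ?thesis by simp
  qed
  ultimately show ?thesis
    unfolding y_def by linarith
qed

section \<open>Divisibility for the reduced triple\<close>

text \<open>A common divisor of two of \<open>A\<close>, \<open>B\<close>, \<open>C\<close> divides
  the third by one of the given divisibilities, so \<open>gcd1\<close> yields pairwise coprimality.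
  Modulo \<open>A\<close> the symmetric sum is \<open>B + C + B * C * H\<close>, and similarly
  modulo \<open>B\<close> and \<open>C\<close>.\<close>

lemma pairwise_coprime_prod_dvd:
  fixes A B C H :: int
  assumes gcd1: "gcd A (gcd B C) = 1"
    and dA: "A dvd B + C + B * C * H"
    and dB: "B dvd A + C + A * C * H"
    and dC: "C dvd A + B + A * B * H"
  shows "A * B * C dvd A + B + C + H * (A * B + B * C + C * A)"
proof -
  have *: "coprime X Y"
    if g: "\<And>e. e dvd X \<Longrightarrow> e dvd Y \<Longrightarrow> e dvd Z \<Longrightarrow> is_unit e"
      and d: "X dvd Y + Z + Y * Z * H" for X Y Z :: int
  proof (rule coprimeI)
    fix e assume e: "e dvd X" "e dvd Y"
    have "e dvd (Y + Z + Y * Z * H) - Y * (1 + Z * H)"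
      using e d by (meson dvd_diff dvd_mult2 dvd_trans)
    then have "e dvd Z"
      by (simp add: algebra_simps)
    then show "is_unit e" using e g by blast
  qed
  have g: "is_unit e" if "e dvd A" "e dvd B" "e dvd C" for e
    using that gcd1 by (metis gcd_greatest)
  have "coprime A B"
    by (rule *[of A B C]) (use g dA in auto)
  moreover have "coprime A C"
    by (rule *[of A C B]) (use g dA in \<open>auto simp: algebra_simps\<close>)
  moreover have "coprime B C"
    by (rule *[of B C A]) (use g dB in \<open>auto simp: algebra_simps\<close>)
  moreover
  let ?S = "A + B + C + H * (A * B + B * C + C * A)"
  have "?S = (B + C + B * C * H) + A * (1 + H * B + H * C)"
    by (simp add: algebra_simps)
  then have "A dvd ?S" using dA by (metis dvd_add dvd_triv_left)
  moreover
  have "?S = (A + C + A * C * H) + B * (1 + H * A + H * C)"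
    by (simp add: algebra_simps)
  then have "B dvd ?S" using dB by (metis dvd_add dvd_triv_left)
  moreover
  have "?S = (A + B + A * B * H) + C * (1 + H * A + H * B)"
    by (simp add: algebra_simps)
  then have "C dvd ?S" using dC by (metis dvd_add dvd_triv_left)
  ultimately show ?thesis
    by (intro divides_mult) auto
qed

section \<open>Size of the quotient \<open>k\<close> and of the excess \<open>d\<close>\<close>

text \<open>The product \<open>B * C\<close> dominates the other two, so the term with
  \<open>H\<close> is at most \<open>3 * H * B * C = (A + d) * B * C\<close>, while
  \<open>A + B + C < 3 * B * C\<close>. Hence \<open>k \<ge> 2\<close> would force
  \<open>A < d + 3\<close>, which is too small for either alternative in
  \<open>large\<close>.\<close>

lemma quotient_one_if_large:
  fixes A B C H d k :: int
  assumes "0 < A" "A < B" "B < C" "1 < H" and d: "3 * H = A + d"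
    and large: "d \<le> 0 \<or> 6 * d\<^sup>2 - d \<le> A"
    and eq: "k * (A * B * C) = A + B + C + H * (A * B + B * C + C * A)"
  shows "k = 1"
proof -
  have BC: "0 < B" "0 < C" using assms by auto
  have "0 < k * (A * B * C)"
    unfolding eq using assms BC by (simp add: add_pos_pos)
  then have "0 < k"
    using assms(1) BC by (auto intro: zero_less_mult_pos2)
  moreover have "\<not> 2 \<le> k"
  proof
    assume "2 \<le> k"
    then have "2 * (A * B * C) \<le> A + B + C + H * (A * B + B * C + C * A)"
      using eq assms BC by (metis mult_right_mono less_imp_le mult_pos_pos)
    moreover have "A * B \<le> B * C" "C * A \<le> B * C"
      using assms BC by (auto simp: mult.commute mult_mono)
    then have "A * B + B * C + C * A \<le> 3 * (B * C)" by linarith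
    then have "H * (A * B + B * C + C * A) \<le> H * (3 * (B * C))"
      using assms(4) by (intro mult_left_mono) auto
    moreover have "H * (3 * (B * C)) = (A + d) * (B * C)"
      using d by (metis mult.assoc mult.commute)
    ultimately have "A * (B * C) \<le> A + B + C + d * (B * C)"
      by (simp add: algebra_simps)
    moreover have "A + B + C < 3 * (B * C)"
    proof -
      have "C * 1 < C * B" "B * 1 \<le> B * C"
        using assms BC by (auto simp: mult_left_mono)
      then show ?thesis
        using assms(1-3) mult.commute[of C B] by linarith
    qed
    ultimately have "A * (B * C) < (d + 3) * (B * C)"
      by (simp add: algebra_simps)
    then have "A < d + 3"
      using BC by simp
    \<comment> \<open>For \<open>d \<ge> 1\<close> the bound \<open>A < d + 3\<close> is
      incompatible with \<open>large\<close>. For \<open>d \<le> 0\<close> it gives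
      \<open>A < 3\<close>, hence \<open>3 * H < 3\<close>, against \<open>1 < H\<close>.\<close>
    have "d \<le> 0"
    proof (rule ccontr)
      assume "\<not> d \<le> 0"
      then have "6 * d\<^sup>2 < 2 * d + 3" "1 * d \<le> d * d"
        using large \<open>A < d + 3\<close> by (linarith, intro mult_right_mono) auto
      then show False using \<open>\<not> d \<le> 0\<close> by (simp add: power2_eq_square)
    qed
    then show False
      using \<open>A < d + 3\<close> d assms by linarith
  qed
  ultimately show ?thesis by simp
qed

lemma excess_lower_bounds:
  fixes A B C H d k :: int
  assumes ord: "0 < A" "A < B" "B < C" and H: "1 < H" "even H" and d: "3 * H = A + d"
    and eq: "k * (A * B * C) = A + B + C + H * (A * B + B * C + C * A)"
  shows "1 \<le> d" and "A < 6 * d\<^sup>2 - d"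
proof -
  define b c where "b = B - A" and "c = C - A"
  have B: "B = A + b" and C: "C = A + c" and bc: "1 \<le> b" "b < c"
    using ord by (auto simp: b_def c_def)
  have main: "1 \<le> d \<and> A < 6 * d\<^sup>2 - d"
  proof (rule ccontr)
    assume neg: "\<not> ?thesis"
    then have "k = 1"
      using quotient_one_if_large[OF ord H(1) d _ eq] by auto
    define m where "m = b * c"
    \<comment> \<open>The right side of the equation contributes \<open>3 * d * A^2\<close>, to be
      compared with \<open>A^2 * (b + c)\<close> on the left; \<open>t\<close> is what remains of
      the coefficient of \<open>A^2\<close>.\<close>
    define t where "t = b + c - 3 * d"
    have "m > 0" using bc by (simp add: m_def)
    have "0 \<le> (b - 1) * (c - 1)" using bc by simp
    then have m_lower: "3 * d + t - 1 \<le> m"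
      by (simp add: m_def t_def algebra_simps)
    have "3 * (A * B * C) = 3 * (A + B + C) + (A + d) * (A * B + B * C + C * A)"
      using eq d \<open>k = 1\<close> by (simp add: algebra_simps flip: d)
    then have raw: "A\<^sup>2 * (b + c) + 2 * A * m
        = 9 * A + 3 * (b + c) + d * (A * B + B * C + C * A)"
      unfolding B C m_def by (simp add: power2_eq_square algebra_simps)
    then have key: "A\<^sup>2 * t + A * (2 * m - 9 - 2 * d * (3 * d + t)) - 3 * (3 * d + t) - d * m = 0"
      unfolding B C m_def t_def by (simp add: power2_eq_square algebra_simps)
    show False
    proof (cases "d \<le> 0")
      case True
      then have "A \<ge> 6" using d H by presburger
      have "d * (A * B + B * C + C * A) \<le> 0"
        using True ord by (intro mult_nonpos_nonneg) auto
      moreover have "0 < 2 * A * m" using ord \<open>m > 0\<close> by simp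
      ultimately have "(A\<^sup>2 - 3) * (b + c) < 9 * A"
        using raw by (simp add: algebra_simps)
      moreover have "6 * A \<le> A\<^sup>2"
        using \<open>A \<ge> 6\<close> by (simp add: power2_eq_square)
      moreover from this have "(A\<^sup>2 - 3) * 3 \<le> (A\<^sup>2 - 3) * (b + c)"
        using \<open>A \<ge> 6\<close> bc by (intro mult_left_mono) auto
      ultimately show False using \<open>A \<ge> 6\<close> by (simp add: algebra_simps)
    next
      case False
      then have "d \<ge> 1" and large: "6 * d\<^sup>2 - d \<le> A" using neg by auto
      then have "d \<le> d * d" by simp
      then have "5 * d \<le> A" using large by (simp add: power2_eq_square)
      \<comment> \<open>For \<open>t \<le> 0\<close>, the inequality
        \<open>4 * b * c \<le> (b + c)^2\<close> makes the coefficient of \<open>A\<close> in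
        \<open>key\<close> negative, and then the whole left side is negative.\<close>
      have "t \<ge> 1"
      proof (rule ccontr)
        assume "\<not> t \<ge> 1"
        then have t: "t \<le> 0" "b + c \<le> 3 * d" by (auto simp: t_def)
        have "4 * m \<le> (b + c) * (b + c)"
          using zero_le_square[of "b - c"] by (simp add: m_def algebra_simps)
        also have "\<dots> \<le> 3 * d * (b + c)"
          using t bc by (intro mult_right_mono) auto
        finally have "2 * m - 9 - 2 * d * (3 * d + t) < 0"
          using \<open>d \<ge> 1\<close> bc mult_pos_pos[of d "b + c"] by (simp add: t_def algebra_simps)
        moreover define F where "F = 2 * m - 9 - 2 * d * (3 * d + t)"
        ultimately have "A * F < 0"
          using ord by (simp add: mult_pos_neg)
        moreover have "A\<^sup>2 * t \<le> 0" "0 < d * m"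
          using t \<open>d \<ge> 1\<close> \<open>m > 0\<close> by (auto simp: mult_nonneg_nonpos)
        moreover have "0 < 3 * d + t" using bc by (simp add: t_def)
        ultimately show False
          using key unfolding F_def[symmetric] by (smt (verit))
      qed
      \<comment> \<open>The left side of \<open>key\<close> is nondecreasing in \<open>m\<close>
        and, after \<open>m\<close> is lowered to \<open>3 * d + t - 1\<close>, also in
        \<open>t\<close>. Together the two products compare it with its value at
        \<open>t = 1\<close>, \<open>m = 3 * d\<close>.\<close>
      have "0 \<le> (2 * A - d) * (m - (3 * d + t - 1))"
        using m_lower \<open>5 * d \<le> A\<close> \<open>d \<ge> 1\<close> by simp
      moreover have "0 \<le> (A\<^sup>2 - 2 * d * A - 3 + (2 * A - d)) * (t - 1)"
      proof -
        have "0 \<le> A * (A - 2 * d)"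
          using \<open>5 * d \<le> A\<close> \<open>d \<ge> 1\<close> by simp
        then have "0 \<le> A\<^sup>2 - 2 * d * A"
          by (simp add: power2_eq_square right_diff_distrib mult_ac)
        then have "0 \<le> A\<^sup>2 - 2 * d * A - 3 + (2 * A - d)"
          using \<open>5 * d \<le> A\<close> \<open>d \<ge> 1\<close> by linarith
        then show ?thesis using \<open>t \<ge> 1\<close> by simp
      qed
      ultimately have upper: "A * (A - 6 * d\<^sup>2 + 4 * d - 9) \<le> 3 * d\<^sup>2 + 9 * d + 3"
        using key by (simp add: power2_eq_square algebra_simps)
      have "d \<le> 3"
      proof (rule ccontr)
        assume "\<not> d \<le> 3"
        then have "d \<ge> 4" by simp
        then have "4 * d \<le> d * d" by simp
        \<comment> \<open>By \<open>large\<close> the second factor is at least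
          \<open>3 * d - 9\<close>, hence at least 3 once \<open>d \<ge> 4\<close>.\<close>
        have "A * 3 \<le> A * (A - 6 * d\<^sup>2 + 4 * d - 9)"
          using large \<open>d \<ge> 4\<close> ord by (intro mult_left_mono) auto
        then have "A * 3 \<le> 3 * d\<^sup>2 + 9 * d + 3"
          using upper by (rule order_trans)
        then have "A \<le> d\<^sup>2 + 3 * d + 1" by presburger
        with large have "6 * d\<^sup>2 - d \<le> d\<^sup>2 + 3 * d + 1" by (rule order_trans)
        then show False using \<open>4 * d \<le> d * d\<close> \<open>d \<ge> 4\<close>
          by (simp add: power2_eq_square)
      qed
      then consider "d = 1" | "d = 2" | "d = 3" using \<open>d \<ge> 1\<close> by linarith
      then show False
      proof cases
        case 1
        have "A < 13"
        proof (rule ccontr)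
          assume "\<not> A < 13"
          then have "13 * 2 \<le> A * (A - 11)" by (intro mult_mono) auto
          then show False using upper 1 by simp
        qed
        \<comment> \<open>As \<open>H\<close> is even, \<open>A + d\<close> is a multiple of 6; the
          same congruence isolates the single values of \<open>A\<close> for \<open>d = 2\<close>
          and \<open>d = 3\<close>.\<close>
        then have "A = 5 \<or> A = 11" using d 1 large H by presburger
        then show False
        proof
          assume "A = 5"
          then have e: "4 * (b + c) + 3 * (b * c) = 40"
            using key 1 by (simp add: t_def m_def)
          have "b < 4"
          proof (rule ccontr)
            assume "\<not> b < 4"
            then have "4 * 4 \<le> b * c" using bc by (intro mult_mono) auto
            then have "16 \<le> b * c" "40 < 3 * (b * c)" by simp_all
            then show False using e bc by simp
          qed
          then have "b = 1 \<or> b = 2 \<or> b = 3" using bc by linarith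
          then show False using e by (elim disjE) (simp; presburger)+
        next
          assume "A = 11"
          with key 1 have "96 * t + 21 * m = 174"
            by (simp add: algebra_simps)
          \<comment> \<open>Already \<open>t = 2\<close> overshoots the right side, and
            \<open>t = 1\<close> leaves \<open>21 * m = 78\<close>, impossible modulo 7. The last
            two cases end likewise, with \<open>42 * m = 351\<close> (parity) and
            \<open>99 * m = 948\<close> (modulo 9).\<close>
          moreover from this have "t = 1"
            using \<open>t \<ge> 1\<close> \<open>m > 0\<close> by linarith
          ultimately show False by simp presburger
        qed
      next
        case 2
        have "A < 27"
        proof (rule ccontr)
          assume "\<not> A < 27"
          then have "27 * 2 \<le> A * (A - 25)" by (intro mult_mono) auto
          then show False using upper 2 by simp
        qed
        then have "A = 22" using d 2 large H by simp presburger
        with key 2 have "393 * t + 42 * m = 744"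
          by (simp add: algebra_simps)
        moreover from this have "t = 1"
          using \<open>t \<ge> 1\<close> \<open>m > 0\<close> by linarith
        ultimately show False by simp presburger
      next
        case 3
        have "A < 53"
        proof (rule ccontr)
          assume "\<not> A < 53"
          then have "53 * 2 \<le> A * (A - 51)" by (intro mult_mono) auto
          then show False using upper 3 by simp
        qed
        then have "A = 51" using d 3 large H by simp presburger
        with key 3 have "2292 * t + 99 * m = 3240"
          by (simp add: algebra_simps)
        moreover from this have "t = 1"
          using \<open>t \<ge> 1\<close> \<open>m > 0\<close> by linarith
        ultimately show False by simp presburger
      qed
    qed
  qed
  then show "1 \<le> d" and "A < 6 * d\<^sup>2 - d" by auto
qed

section \<open>From the Korselt factorisation to the reduced triple\<close>

theorem theorem4p2:
  fixes n p q r :: int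
  assumes "K3N n p q r"
  shows "real_of_int (K3N_A p q r) <
           sqrt (3 * (real_of_int p - 1)) - 1 / 2 * root 4 ((real_of_int p - 1) / 12)"
proof -
  have n: "n = p * q * r" and ord: "1 < p" "p < q" "q < r"
    and par: "odd p" "odd q" "odd r"
    and dvds: "(p - 1) dvd (n - 1)" "(q - 1) dvd (n - 1)" "(r - 1) dvd (n - 1)"
    using assms by (auto simp: K3N_def)
  define H A B C where "H = K3N_H p q r" and "A = K3N_A p q r"
    and "B = (q - 1) div H" and "C = (r - 1) div H"
  have "even H" "H dvd q - 1" "H dvd r - 1" "0 < H"
    using par ord by (auto simp: H_def K3N_H_def intro: dvd_trans[OF gcd_dvd2])
  have p: "p = 1 + A * H"
    using K3N_A_exact[of p q r] by (simp add: A_def H_def)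
  have q: "q = 1 + B * H" and r: "r = 1 + C * H"
    using \<open>H dvd q - 1\<close> \<open>H dvd r - 1\<close> by (simp_all add: B_def C_def)
  have ABC: "0 < A" "A < B" "B < C"
    using ord \<open>0 < H\<close> unfolding p q r by (simp_all add: zero_less_mult_iff)
  have "p - 1 = H * A" "q - 1 = H * B" "r - 1 = H * C"
    using p q r by (simp_all only: add_diff_cancel_left' mult.commute)
  then have "H = gcd (H * A) (gcd (H * B) (H * C))"
    by (metis H_def K3N_H_def)
  also have "\<dots> = H * gcd A (gcd B C)"
    using \<open>0 < H\<close> by (simp flip: gcd_mult_distrib_int)
  finally have gcd1: "gcd A (gcd B C) = 1"
    using \<open>0 < H\<close> by simp
  \<comment> \<open>Modulo \<open>X * H\<close> the product of the three factors minus 1 reduces to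
    \<open>(Y + Z + Y * Z * H) * H\<close>, from which \<open>H\<close> cancels.\<close>
  have *: "X dvd Y + Z + Y * Z * H"
    if "X * H dvd (1 + X * H) * (1 + Y * H) * (1 + Z * H) - 1" for X Y Z
  proof -
    have "(1 + X * H) * (1 + Y * H) * (1 + Z * H) - 1
        = X * H * ((1 + Y * H) * (1 + Z * H)) + (Y + Z + Y * Z * H) * H"
      by (simp add: algebra_simps)
    then have "X * H dvd (Y + Z + Y * Z * H) * H"
      using that by (metis dvd_add_right_iff dvd_triv_left)
    then show ?thesis using \<open>0 < H\<close> by simp
  qed
  have "A * B * C dvd A + B + C + H * (A * B + B * C + C * A)"
    using dvds unfolding n p q r
    by (intro pairwise_coprime_prod_dvd[OF gcd1] *) (simp_all add: mult_ac)
  then obtain k where k: "k * (A * B * C) = A + B + C + H * (A * B + B * C + C * A)"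
    by (metis dvd_def mult.commute)
  define d where "d = 3 * H - A"
  have "1 < H" using \<open>even H\<close> \<open>0 < H\<close> by presburger
  then have "1 \<le> d" and dA: "A < 6 * d\<^sup>2 - d"
    using excess_lower_bounds[OF ABC _ \<open>even H\<close> _ k, of d] by (auto simp: d_def)
  have gap: "96 * A\<^sup>2 + A + 96 * A * d + d < 576 * A * d\<^sup>2"
  \<comment> \<open>Integrality of \<open>dA\<close> gives \<open>A + 1 \<le> 6 * d^2 - d\<close>;
    multiplied by \<open>96 * A\<close>, this has \<open>96 * A\<close> to spare, which exceeds
    \<open>A + d\<close> as long as \<open>d < 95 * A\<close>. For larger \<open>d\<close>, every
    term on the left is at most a multiple of \<open>A * d\<close>, with total 194 < 576.\<close>
  proof (cases "d \<le> 95 * A - 1")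
    case True
    have "96 * A * (A + 1) \<le> 96 * A * (6 * d\<^sup>2 - d)"
      using dA ABC by (intro mult_left_mono) auto
    then show ?thesis using True ABC by (simp add: power2_eq_square algebra_simps)
  next
    case False
    then have "96 * A * A \<le> 96 * A * d"
      using ABC by (intro mult_left_mono) auto
    moreover have "A * d \<le> A * d * d" "1 * d \<le> A * d" "A * 1 \<le> A * d"
      using ABC \<open>1 \<le> d\<close> by (auto intro: mult_right_mono mult_left_mono)
    moreover have "0 < A * d" using ABC \<open>1 \<le> d\<close> by simp
    ultimately show ?thesis by (simp add: power2_eq_square mult.assoc)
  qed
  have "real_of_int A < sqrt (3 * (real_of_int A * real_of_int H))
      - 1 / 2 * root 4 ((real_of_int A * real_of_int H) / 12)"
  proof (rule less_sqrt_minus_root_if_excess_large)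
    show "3 * real_of_int H = real_of_int A + real_of_int d"
      by (simp add: d_def)
    show "96 * (real_of_int A)\<^sup>2 + real_of_int A + 96 * real_of_int A * real_of_int d + real_of_int d
        < 576 * real_of_int A * (real_of_int d)\<^sup>2"
      using gap by (simp flip: of_int_less_iff[where 'a = real])
  qed (use ABC \<open>1 \<le> d\<close> in auto)
  moreover have "real_of_int A * real_of_int H = real_of_int p - 1"
    by (subst p) simp
  ultimately show ?thesis
    by (simp only: A_def)
qed

end
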